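(* Let $\mathcal{X}$ be a Banach space over $\mathbb{K}$ and let $\{\tau_n\}_{n=1}^\infty$ be a sequence in $\mathcal{X}$ such that the map $$\theta_\tau:\ell^1(\mathbb{N})\ni \{a_n\}_{n=1}^\infty\mapsto \theta_\tau\{a_n\}_{n=1}^\infty:=\sum_{n=1}^{\infty}a_n\tau_n\in\mathcal{X}$$ is a well-defined bounded linear surjective operator. Assume that there is a sequence $\{f_n\}_{n=1}^\infty$ in $\mathcal{X}^*$ such that the map $$\theta_f:\mathcal{X}\ni x\mapsto \theta_f x:=\{f_n(x)\}_{n=1}^\infty\in\ell^1(\mathbb{N})$$ is a well-defined bounded linear operator and $$|f_n(\tau_n)|\geq 1,\quad \forall n\in\mathbb{N}.$$ If $x\in\mathcal{X}$ can be written as $x=\theta_\tau c$ for some $c\in\ell^1(\mathbb{N})$ satisfying $$\|c\|_0<\frac{1}{2}\left(1+\frac{1}{\displaystyle\sup_{n,m\in\mathbb{N},\,n\neq m}|f_n(\tau_m)|}\right),$$ then $c$ is the unique solution to the problem $$\underset{d\in\ell^1(\mathbb{N})}{\operatorname{minimize}}\ \|d\|_1\quad\text{subject to}\quad \theta_\tau d=x.$$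
   Context: $\mathbb{K}$ denotes $\mathbb{R}$ or $\mathbb{C}$; $\mathcal{X}$ need not be finite dimensional; $\mathcal{X}^*$ is the (continuous) dual of $\mathcal{X}$; $\mathbb{N}=\{1,2,3,\dots\}$; $\ell^1(\mathbb{N})$ is the space of absolutely summable $\mathbb{K}$-valued sequences with norm $\|\cdot\|_1$. For $d\in\ell^1(\mathbb{N})$, $\|d\|_0\in\{0,1,2,\dots\}\cup\{\infty\}$ is the number of nonzero entries of $d$. The convention $1/0=+\infty$ is used. That $c\in\ell^1(\mathbb{N})$ is the unique solution to the stated minimization problem means: (1) $\theta_\tau c=x$; and (2) if $d\in\ell^1(\mathbb{N})$ satisfies $\theta_\tau d=x$ and $d\neq c$, then $\|d\|_1>\|c\|_1$. *)

theory Defs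
  imports "HOL-Analysis.Analysis" "HOL-Library.Function_Algebras"
begin

text \<open>
  The scalar field is a type of class \<^class>\<open>real_normed_field\<close>. It has the instances
  \<^typ>\<open>real\<close> and \<^typ>\<open>complex\<close>, and by Mazur's theorem it has no others up to isometric
  isomorphism.

  The type class \<^class>\<open>banach\<close> only knows real scalars, so multiplication by elements of the
  field is a parameter. The last assumption says that the real structure of the type is obtained
  from it by restriction of scalars.
\<close>

locale banach_space_over = vector_space scl
  for scl :: "'k::real_normed_field \<Rightarrow> 'x::banach \<Rightarrow> 'x" +
  assumes norm_scale: "norm (scl a x) = norm a * norm x"
    and scale_of_real: "scl (of_real r) x = r *\<^sub>R x"

lemma banach_space_over_scaleR: "banach_space_over (scaleR :: real \<Rightarrow> 'x::banach \<Rightarrow> 'x)"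
  by unfold_locales (simp_all add: algebra_simps)

lemma banach_space_over_mult:
  "banach_space_over ((*) :: 'k \<Rightarrow> 'k \<Rightarrow> 'k::{real_normed_field,banach})"
  by unfold_locales (simp_all add: algebra_simps norm_mult scaleR_conv_of_real)

definition continuous_dual ::
    "('k::real_normed_field \<Rightarrow> 'x::banach \<Rightarrow> 'x) \<Rightarrow> ('x \<Rightarrow> 'k) set" where
  "continuous_dual scl =
    {\<phi>. Vector_Spaces.linear scl (*) \<phi> \<and> continuous_on UNIV \<phi>}"

text \<open>Sequences are indexed by \<^typ>\<open>nat\<close>, hence from 0 instead of 1.\<close>

definition l1 :: "(nat \<Rightarrow> 'k::real_normed_field) set" where
  "l1 = {a. summable (\<lambda>n. norm (a n))}"

definition norm_l1 :: "(nat \<Rightarrow> 'k::real_normed_field) \<Rightarrow> real" where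
  "norm_l1 a = (\<Sum>n. norm (a n))"

definition norm_l0 :: "(nat \<Rightarrow> 'k::real_normed_field) \<Rightarrow> enat" where
  "norm_l0 a = (if finite {n. a n \<noteq> 0} then enat (card {n. a n \<noteq> 0}) else \<infinity>)"

definition scale_seq :: "'k::real_normed_field \<Rightarrow> (nat \<Rightarrow> 'k) \<Rightarrow> (nat \<Rightarrow> 'k)" where
  "scale_seq k a = (\<lambda>n. k * a n)"

text \<open>
  Bounded linear operators from the normed space with carrier \<open>V\<close>, scalar multiplication \<open>sV\<close>
  and norm \<open>nV\<close> to the one given by \<open>W\<close>, \<open>sW\<close>, \<open>nW\<close>. Addition is that of the types; for
  sequences it is pointwise.
\<close>

definition bounded_linear_between ::
    "'v::plus set \<Rightarrow> ('k \<Rightarrow> 'v \<Rightarrow> 'v) \<Rightarrow> ('v \<Rightarrow> real) \<Rightarrow>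
     'w::plus set \<Rightarrow> ('k \<Rightarrow> 'w \<Rightarrow> 'w) \<Rightarrow> ('w \<Rightarrow> real) \<Rightarrow> ('v \<Rightarrow> 'w) \<Rightarrow> bool" where
  "bounded_linear_between V sV nV W sW nW T \<longleftrightarrow>
     (\<forall>u\<in>V. T u \<in> W) \<and>
     (\<forall>u\<in>V. \<forall>v\<in>V. T (u + v) = T u + T v) \<and>
     (\<forall>k. \<forall>u\<in>V. T (sV k u) = sW k (T u)) \<and>
     (\<exists>C. \<forall>u\<in>V. nW (T u) \<le> C * nV u)"

text \<open>
  The maps $\theta_\tau$ and $\theta_f$. As \<^const>\<open>suminf\<close> is total, convergence of the series
  has to be required separately.
\<close>

definition synthesis ::
    "('k::real_normed_field \<Rightarrow> 'x::banach \<Rightarrow> 'x) \<Rightarrow> (nat \<Rightarrow> 'x) \<Rightarrow> (nat \<Rightarrow> 'k) \<Rightarrow> 'x" where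
  "synthesis scl \<tau> a = (\<Sum>n. scl (a n) (\<tau> n))"

definition analysis :: "(nat \<Rightarrow> 'x \<Rightarrow> 'k) \<Rightarrow> 'x \<Rightarrow> (nat \<Rightarrow> 'k)" where
  "analysis f x = (\<lambda>n. f n x)"

definition unique_l1_minimizer ::
    "('k::real_normed_field \<Rightarrow> 'x::banach \<Rightarrow> 'x) \<Rightarrow> (nat \<Rightarrow> 'x) \<Rightarrow> 'x \<Rightarrow> (nat \<Rightarrow> 'k) \<Rightarrow> bool" where
  "unique_l1_minimizer scl \<tau> x c \<longleftrightarrow>
     c \<in> l1 \<and> synthesis scl \<tau> c = x \<and>
     (\<forall>d\<in>l1. synthesis scl \<tau> d = x \<and> d \<noteq> c \<longrightarrow> norm_l1 d > norm_l1 c)"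

end

theory Submission
  imports Defs
begin

text \<open>
  The constraint set of the minimization problem is $c$ plus the kernel of $\theta_\tau$, so the
  task is to compare $c$ with $c + b$ for nonzero $b$ in the kernel. On the support $S$ of $c$,
  passing to $c + b$ can lower the $\ell^1$ norm by at most $\sum_{n\in S}|b_n|$; off $S$ the norm
  grows by exactly $\sum_{n\notin S}|b_n|$. Hence $c$ wins as soon as every nonzero kernel
  element carries less than half of its mass on $S$ (the null space property,
  \<open>norm_l1_less_if_less_half_mass_on_support\<close>).

  The functionals $f_n$ prevent the concentration of kernel elements. Applying $f_n$ to
  $\sum_m b_m \tau_m = 0$ expresses $b_n f_n(\tau_n)$ through the other coordinates, and as the
  diagonal values $f_n(\tau_n)$ have modulus at least 1 while the off-diagonal ones are bounded by
  their supremum $M$, each coordinate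
  satisfies $(1+M)|b_n| \le M \|b\|_1$ (\<open>kernel_coordinate_bound\<close>). Summing over $S$ bounds
  the mass on $S$ by $\|c\|_0 \, M/(1+M) \, \|b\|_1$, and the sparsity hypothesis
  $2\|c\|_0 < 1 + 1/M$ says that this factor is below one half.
\<close>

lemma l1_diff:
  assumes "a \<in> l1" "b \<in> l1"
  shows "a - b \<in> l1"
proof -
  have "summable (\<lambda>n. norm (a n) + norm (b n))"
    using assms by (intro summable_add) (auto simp: l1_def)
  then have "summable (\<lambda>n. norm (a n - b n))"
    by (rule summable_comparison_test'[where N = 0]) (simp add: norm_triangle_ineq4)
  then show ?thesis by (simp add: l1_def)
qed

lemma norm_l1_pos:
  assumes "b \<in> l1" "b \<noteq> 0"
  shows "norm_l1 b > 0"
proof -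
  obtain n where "b n \<noteq> 0" using assms(2) by (auto simp: fun_eq_iff)
  then show ?thesis
    using assms(1) unfolding norm_l1_def l1_def by (auto intro!: suminf_pos2[of _ n])
qed

text \<open>
  Both $\|c+b\|_1 - \|c\|_1$ and $\|b\|_1 - 2\sum_{n\in S}|b_n|$ are series, and the second is
  termwise below the first: on \<open>S\<close> by the triangle inequality, off \<open>S\<close> with equality because \<open>c\<close>
  vanishes there.
\<close>

lemma norm_l1_less_if_less_half_mass_on_support:
  assumes b: "b \<in> l1" and c: "c \<in> l1" and cb: "c + b \<in> l1"
    and S: "finite S" "\<And>n. n \<notin> S \<Longrightarrow> c n = 0"
    and half: "2 * (\<Sum>n\<in>S. norm (b n)) < norm_l1 b"
  shows "norm_l1 c < norm_l1 (c + b)"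
proof -
  have sb: "summable (\<lambda>n. norm (b n))" and sc: "summable (\<lambda>n. norm (c n))"
    and scb: "summable (\<lambda>n. norm ((c + b) n))"
    using b c cb by (auto simp: l1_def)
  let ?g = "\<lambda>n. if n \<in> S then norm (b n) else 0"
  have g: "?g sums (\<Sum>n\<in>S. norm (b n))"
    using sums_If_finite_set[OF S(1)] .
  have lower: "(\<lambda>n. norm (b n) - 2 * ?g n) sums (norm_l1 b - 2 * (\<Sum>n\<in>S. norm (b n)))"
    unfolding norm_l1_def by (intro sums_diff sums_mult g summable_sums sb)
  have upper: "(\<lambda>n. norm ((c + b) n) - norm (c n)) sums (norm_l1 (c + b) - norm_l1 c)"
    unfolding norm_l1_def by (intro sums_diff summable_sums sc scb)
  have "norm (b n) - 2 * ?g n \<le> norm ((c + b) n) - norm (c n)" for n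
    using S(2)[of n] norm_diff_ineq[of "c n" "b n"] by auto
  then have "norm_l1 b - 2 * (\<Sum>n\<in>S. norm (b n)) \<le> norm_l1 (c + b) - norm_l1 c"
    by (rule sums_le[OF _ lower upper])
  with half show ?thesis by linarith
qed

lemma continuous_dual_sums:
  assumes "\<phi> \<in> continuous_dual scl" "(\<lambda>m. scl (b m) (\<tau> m)) sums y"
  shows "(\<lambda>m. b m * \<phi> (\<tau> m)) sums \<phi> y"
proof -
  interpret \<phi>: Vector_Spaces.linear scl "(*)" \<phi>
    using assms(1) by (simp add: continuous_dual_def)
  have "isCont \<phi> y"
    using assms(1) by (simp add: continuous_dual_def continuous_on_eq_continuous_at)
  then have "(\<lambda>N. \<phi> (\<Sum>m<N. scl (b m) (\<tau> m))) \<longlonglongrightarrow> \<phi> y"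
    using assms(2) unfolding sums_def by (rule isCont_tendsto_compose)
  then show ?thesis
    by (simp add: sums_def \<phi>.sum \<phi>.scale)
qed

text \<open>
  Moving the diagonal term to the other side leaves
  $|b_n| \le |b_n g_n| = |\sum_{m\neq n} b_m g_m| \le M (\|b\|_1 - |b_n|)$. The last step is the
  triangle inequality for an infinite series; as an absolutely convergent series may diverge in an
  incomplete field, it is derived from the finite one for partial sums.
\<close>

lemma kernel_coordinate_bound:
  fixes b g :: "nat \<Rightarrow> 'k::real_normed_field"
  assumes b: "b \<in> l1" and zero: "(\<lambda>m. b m * g m) sums 0"
    and diag: "norm (g n) \<ge> 1" and off: "\<And>m. m \<noteq> n \<Longrightarrow> norm (g m) \<le> M" and M: "M \<ge> 0"
  shows "(1 + M) * norm (b n) \<le> M * norm_l1 b"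
proof -
  let ?P = "\<lambda>N. \<Sum>m<N. b m * g m"
  have sb: "summable (\<lambda>m. norm (b m))" using b by (simp add: l1_def)
  have "norm (b n) \<le> norm (?P N) + M * (norm_l1 b - norm (b n))" if "N \<ge> Suc n" for N
  proof -
    let ?A = "{..<N} - {n}"
    have n: "n \<in> {..<N}" using that by auto
    have "norm (b n) \<le> norm (b n * g n)"
      using mult_left_mono[OF diag norm_ge_zero[of "b n"]] by (simp add: norm_mult)
    also have "b n * g n = ?P N - (\<Sum>m\<in>?A. b m * g m)"
      using sum.remove[OF _ n, of "\<lambda>m. b m * g m"] by simp
    also have "norm \<dots> \<le> norm (?P N) + norm (\<Sum>m\<in>?A. b m * g m)"
      by (rule norm_triangle_ineq4)
    also have "norm (\<Sum>m\<in>?A. b m * g m) \<le> (\<Sum>m\<in>?A. M * norm (b m))"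
      by (rule sum_norm_le) (auto simp: norm_mult mult.commute[of M] intro!: mult_left_mono off)
    also have "\<dots> = M * ((\<Sum>m<N. norm (b m)) - norm (b n))"
      using sum.remove[OF _ n, of "\<lambda>m. norm (b m)"] by (simp add: sum_distrib_left)
    also have "\<dots> \<le> M * (norm_l1 b - norm (b n))"
      unfolding norm_l1_def using M sum_le_suminf[OF sb, of "{..<N}"]
      by (intro mult_left_mono) auto
    finally show ?thesis by simp
  qed
  moreover have "(\<lambda>N. norm (?P N) + M * (norm_l1 b - norm (b n)))
      \<longlonglongrightarrow> 0 + M * (norm_l1 b - norm (b n))"
    using zero unfolding sums_def by (intro tendsto_intros tendsto_norm_zero)
  ultimately have "norm (b n) \<le> 0 + M * (norm_l1 b - norm (b n))"
    by (intro LIMSEQ_le_const) auto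
  then show ?thesis by (simp add: algebra_simps)
qed

text \<open>
  The sparsity hypothesis in real arithmetic. Multiplying out by \<open>M\<close> removes the convention
  $1/0 = \infty$: for \<open>M = 0\<close> the conclusion holds for every \<open>k\<close>.
\<close>

lemma sparsity_bound_real:
  assumes "ennreal (real k) < 1 / 2 * (1 + 1 / ennreal M)" and M: "M \<ge> 0"
  shows "2 * real k * M < 1 + M"
proof (cases "M = 0")
  case False
  with M have "M > 0" by simp
  have "1 + 1 / ennreal M = ennreal (1 + 1 / M)"
    using divide_ennreal[of 1 M] ennreal_plus[of 1 "1 / M"] \<open>M > 0\<close> by simp
  then have "1 / 2 * (1 + 1 / ennreal M) = ennreal (1 / 2 * (1 + 1 / M))"
    using ennreal_mult[of "1 / 2" "1 + 1 / M"] divide_ennreal[of 1 2] M by simp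
  with assms(1) have "real k < 1 / 2 * (1 + 1 / M)"
    by (simp only: ennreal_less_iff of_nat_0_le_iff)
  with \<open>M > 0\<close> show ?thesis by (simp add: field_simps)
qed simp

text \<open>
  For finite \<open>\<mu>\<close> the coordinate bounds are added up over \<open>S\<close>. An infinite \<open>\<mu>\<close> is covered by the
  sparsity hypothesis itself: with $1/\infty = 0$ it forces \<open>S\<close> to be empty.
\<close>

lemma less_half_mass_on_sparse_set:
  fixes b :: "nat \<Rightarrow> 'k::real_normed_field"
  assumes pos: "norm_l1 b > 0"
    and coord: "\<And>M n. \<lbrakk>M \<ge> 0; \<mu> = ennreal M\<rbrakk> \<Longrightarrow> (1 + M) * norm (b n) \<le> M * norm_l1 b"
    and sparse: "ennreal (real (card S)) < 1 / 2 * (1 + 1 / \<mu>)" and S: "finite S"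
  shows "2 * (\<Sum>n\<in>S. norm (b n)) < norm_l1 b"
proof (cases \<mu>)
  case (real M)
  have "(1 + M) * (\<Sum>n\<in>S. norm (b n)) \<le> (\<Sum>n\<in>S. M * norm_l1 b)"
    unfolding sum_distrib_left by (intro sum_mono coord real)
  then have "(1 + M) * (2 * (\<Sum>n\<in>S. norm (b n))) \<le> (2 * real (card S) * M) * norm_l1 b"
    by (simp add: algebra_simps)
  also have "\<dots> < (1 + M) * norm_l1 b"
    using sparsity_bound_real[of "card S" M] sparse real pos by (intro mult_strict_right_mono) auto
  finally show ?thesis using real by (simp add: mult_less_cancel_left)
next
  case top
  then have "ennreal (real (card S)) < ennreal (1 / 2)"
    using sparse divide_ennreal[of 1 2] by simp
  then have "real (card S) < 1 / 2" by (simp only: ennreal_less_iff of_nat_0_le_iff)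
  then have "card S = 0" by simp
  then show ?thesis using S pos by simp
qed

theorem theorem2p5:
  fixes scl :: "'k::real_normed_field \<Rightarrow> 'x::banach \<Rightarrow> 'x"
    and \<tau> :: "nat \<Rightarrow> 'x" and f :: "nat \<Rightarrow> 'x \<Rightarrow> 'k"
    and x :: 'x and c :: "nat \<Rightarrow> 'k"
  assumes "banach_space_over scl"
    and "\<And>a. a \<in> l1 \<Longrightarrow> summable (\<lambda>n. scl (a n) (\<tau> n))"
    and "bounded_linear_between l1 scale_seq norm_l1 UNIV scl norm (synthesis scl \<tau>)"
    and "synthesis scl \<tau> ` l1 = UNIV"
    and "\<And>n. f n \<in> continuous_dual scl"
    and "bounded_linear_between UNIV scl norm l1 scale_seq norm_l1 (analysis f)"
    and "\<And>n. norm (f n (\<tau> n)) \<ge> 1"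
    and "c \<in> l1" and "x = synthesis scl \<tau> c"
    and "ennreal_of_enat (norm_l0 c) <
      1 / 2 * (1 + 1 / (SUP (n, m) \<in> {(n, m). n \<noteq> m}. ennreal (norm (f n (\<tau> m)))))"
  shows "unique_l1_minimizer scl \<tau> x c"
proof -
  interpret banach_space_over scl by fact
  let ?S = "{n. c n \<noteq> 0}"
  define \<mu> where "\<mu> = (SUP (n, m) \<in> {(n, m). n \<noteq> m}. ennreal (norm (f n (\<tau> m))))"
  have sparse: "ennreal_of_enat (norm_l0 c) < 1 / 2 * (1 + 1 / \<mu>)"
    using assms(10) by (simp only: \<mu>_def)
  have fin: "finite ?S"
    using sparse by (auto simp: norm_l0_def split: if_splits)
  have card: "ennreal (real (card ?S)) < 1 / 2 * (1 + 1 / \<mu>)"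
    using sparse fin by (simp add: norm_l0_def ennreal_of_nat_eq_real_of_nat)
  have off: "norm (f n (\<tau> m)) \<le> M" if "M \<ge> 0" "\<mu> = ennreal M" "m \<noteq> n" for M n m
  proof -
    have "ennreal (norm (f n (\<tau> m))) \<le> \<mu>"
      unfolding \<mu>_def using that(3) by (intro SUP_upper2[of "(n, m)"]) auto
    then show ?thesis using that by simp
  qed
  have "norm_l1 c < norm_l1 d" if d: "d \<in> l1" "synthesis scl \<tau> d = x" "d \<noteq> c" for d
  proof -
    define b where "b = d - c"
    have b: "b \<in> l1" and d_eq: "d = c + b" and "b \<noteq> 0"
      using d assms(8) by (auto simp: b_def l1_diff)
    have "(\<lambda>m. scl (d m) (\<tau> m) - scl (c m) (\<tau> m)) sums (x - x)"
      using summable_sums[OF assms(2)[OF d(1)]] summable_sums[OF assms(2)[OF assms(8)]]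
        d(2) assms(9) unfolding synthesis_def by (intro sums_diff) auto
    then have kernel: "(\<lambda>m. scl (b m) (\<tau> m)) sums 0"
      by (simp add: b_def scale_left_diff_distrib)
    have "(\<lambda>m. b m * f n (\<tau> m)) sums 0" for n
    proof -
      interpret f: Vector_Spaces.linear scl "(*)" "f n"
        using assms(5)[of n] by (simp add: continuous_dual_def)
      show ?thesis using continuous_dual_sums[OF assms(5) kernel, of n] by (simp add: f.zero)
    qed
    then have "(1 + M) * norm (b n) \<le> M * norm_l1 b" if "M \<ge> 0" "\<mu> = ennreal M" for M n
      using b assms(7) off that by (intro kernel_coordinate_bound[where g = "\<lambda>m. f n (\<tau> m)"]) auto
    then have "2 * (\<Sum>n\<in>?S. norm (b n)) < norm_l1 b"
      using norm_l1_pos[OF b \<open>b \<noteq> 0\<close>] card fin by (intro less_half_mass_on_sparse_set)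
    then show ?thesis
      using b assms(8) d(1) fin unfolding d_eq
      by (intro norm_l1_less_if_less_half_mass_on_support) auto
  qed
  then show ?thesis
    using assms(8,9) by (auto simp: unique_l1_minimizer_def)
qed

end
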